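(* The tableau calculus for HdPL is complete for the class of d-product frames: for every formula $\varphi$, if $\models \varphi$ (that is, $\varphi$ holds at every point of every d-product model), then $\vdash \varphi$ (in the HdPL tableau calculus).
   Context: **Language.** Fix a countable set $\mathbf{Prop}$ of propositional variables and two disjoint countably infinite sets $\mathbf{Nom}_1$, $\mathbf{Nom}_2$ of nominals, disjoint from $\mathbf{Prop}$; $\mathbf{Nom}=\mathbf{Nom}_1\cup\mathbf{Nom}_2$. Letters $i,j,k$ range over $\mathbf{Nom}_1$ and $a,b,c$ over $\mathbf{Nom}_2$. Formulas: $\varphi ::= p \mid i \mid a \mid \neg\varphi \mid \varphi\land\varphi \mid \diamondsuit_1\varphi \mid \diamondsuit_2\varphi \mid @_i\varphi \mid @_a\varphi$ with $p\in\mathbf{Prop}$. **Semantics.** Given a Kripke frame $(W_1,R_1)$ ($W_1$ non-empty countable, $R_1\subseteq W_1\times W_1$) and a multi-modal Kripke frame $(W_2,(R_2(x))_{x\in W_1})$ ($W_2$ non-empty countable, each $R_2(x)\subseteq W_2\times W_2$), the dependent product frame (d-product frame) is $(W,R_h,R_v)$ with $W=W_1\times W_2$; $(x,y)R_h(x',y')$ iff $xR_1x'$ and $y=y'$; $(x,y)R_v(x',y')$ iff $x=x'$ and $yR_2(x)y'$. A d-product model $\mathfrak M=(\mathfrak F,V)$ is a d-product frame with $V:\mathbf{Prop}\cup\mathbf{Nom}\to\mathcal P(W)$ such that $V(i)=\{x\}\times W_2$ for some $x\in W_1$ (denoted $i^V$) and $V(a)=W_1\times\{y\}$ for some $y\in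 W_2$ (denoted $a^V$). Satisfaction: $\mathfrak M,(x,y)\models p$ iff $(x,y)\in V(p)$; $\models i$ iff $x=i^V$; $\models a$ iff $y=a^V$; $\neg,\land$ as usual; $\models\diamondsuit_1\varphi$ (resp. $\diamondsuit_2\varphi$) iff $\varphi$ holds at some $R_h$-successor (resp. $R_v$-successor) of $(x,y)$; $\mathfrak M,(x,y)\models @_i\varphi$ iff $\mathfrak M,(i^V,y)\models\varphi$; $\mathfrak M,(x,y)\models @_a\varphi$ iff $\mathfrak M,(x,a^V)\models\varphi$. **HdPL tableau.** A tableau is a well-founded tree (each node is reached from the root in finitely many steps; branches may be infinite) constructed as follows. Start with a root formula of the form $@_i@_a\neg\varphi$, where $i,a$ do not occur in $\varphi$. Extend each branch by applying the rules below to all nodes as often as possible; no formula can be added to a branch any more if every new formula generated by applying an arbitrary rule already exists in the branch, or if the branch is closed. A branch is a maximal path; $\varphi\in\Theta$ means $\varphi$ occurs in the branch $\Theta$. Rules (premises / formulas added; "$\mid$" means the branch splits): - $[\neg\neg]$: $@_i@_a\neg\neg\varphi\ /\ @_i@_a\varphi$. - $[\land]$: $@_i@_a(\varphi\land\psi)\ /\ @_i@_a\varphi,\ @_i@_a\psi$. - $[\neg\land]$: $@_i@_a\neg(\varphi\land\psi)\ /\ @_i@_a\neg\varphi\mid @_i@_a\neg\psi$. - $[\diamondsuit_1]$: $@_i@_a\diamondsuit_1\varphi\ /\ @_i\diamondsuit_1 j,\ @_j@_a\varphi$, where $j\in\mathbf{Nom}_1$ does not occur in the branch; applied only once per formula.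 - $[\diamondsuit_2^d]$: $@_i@_a\diamondsuit_2\varphi\ /\ @_i@_a\diamondsuit_2 b,\ @_i@_b\varphi$, where $b\in\mathbf{Nom}_2$ does not occur in the branch; applied only once per formula. The added formula $@_i@_a\diamondsuit_2 b$, containing the new nominal $b$, is called an accessibility formula. - $[\neg\diamondsuit_1]$: $@_i@_a\neg\diamondsuit_1\varphi,\ @_i\diamondsuit_1 j\ /\ @_j@_a\neg\varphi$. - $[\neg\diamondsuit_2^d]$: $@_i@_a\neg\diamondsuit_2\varphi,\ @_i@_a\diamondsuit_2 b\ /\ @_i@_b\neg\varphi$. - $[@_1]$: $@_i@_a@_j\varphi\ /\ @_j@_a\varphi$. $[@_2]$: $@_i@_a@_b\varphi\ /\ @_i@_b\varphi$. - $[\neg@_1]$: $@_i@_a\neg@_j\varphi\ /\ @_j@_a\neg\varphi$. $[\neg@_2]$: $@_i@_a\neg@_b\varphi\ /\ @_i@_b\neg\varphi$. - $[Red_1]$: $@_i@_as\ /\ @_is$. $[Red_2]$: $@_i@_at\ /\ @_at$. - $[\neg_1]$: $@_i\neg j\ /\ @_jj$. $[\neg_2]$: $@_a\neg b\ /\ @_bb$. - $[Id_1]$: $@_i@_a\varphi,\ @_ij\ /\ @_j@_a\varphi$. $[Id_2]$: $@_i@_a\varphi,\ @_ab\ /\ @_i@_b\varphi$. - $[Id'_1]$: $@_is,\ @_ij\ /\ @_js$. $[Id'_2]$: $@_at,\ @_ab\ /\ @_bt$. In $Red_1,Id'_1$: $s=k$ or $\neg k$ with $k\in\mathbf{Nom}_1$;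 in $Red_2,Id'_2$: $t=c$ or $\neg c$ with $c\in\mathbf{Nom}_2$. Restriction: when applying $[\diamondsuit_2^d]$, $[Id_1]$ or $[Id_2]$, none of the premises may be an accessibility formula. A branch $\Theta$ is closed if for some $\varphi,i,a$: $@_i@_a\varphi,@_i@_a\neg\varphi\in\Theta$, or $@_i\varphi,@_i\neg\varphi\in\Theta$, or $@_a\varphi,@_a\neg\varphi\in\Theta$; otherwise open. A tableau is closed if all its branches are closed. $\vdash\varphi$ iff there is a closed HdPL tableau whose root formula is $@_i@_a\neg\varphi$, with $i\in\mathbf{Nom}_1$, $a\in\mathbf{Nom}_2$ not occurring in $\varphi$. *)

theory Defs
  imports "HOL-Library.Countable" "HOL-Library.Countable_Set"
    "HOL-Library.Infinite_Typeclass" "HOL-Library.Sublist"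
begin

section \<open>Language\<close>

text \<open>The type variables \<open>'p\<close>, \<open>'n\<close>, \<open>'m\<close> stand for the propositional variables and the nominals of
  the first and second sort. Keeping them as separate types makes the three sets disjoint.\<close>

datatype ('p, 'n, 'm) form =
    Pro 'p
  | Nom1 'n
  | Nom2 'm
  | Neg "('p, 'n, 'm) form"
  | Con "('p, 'n, 'm) form" "('p, 'n, 'm) form"
  | Dia1 "('p, 'n, 'm) form"
  | Dia2 "('p, 'n, 'm) form"
  | At1 'n "('p, 'n, 'm) form"
  | At2 'm "('p, 'n, 'm) form"

abbreviation At12 :: "'n \<Rightarrow> 'm \<Rightarrow> ('p, 'n, 'm) form \<Rightarrow> ('p, 'n, 'm) form" where
  "At12 i a \<phi> \<equiv> At1 i (At2 a \<phi>)"

text \<open>The datatype package's set functions give the nominals occurring in a formula, including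
  those occurring as a subscript of a satisfaction operator.\<close>

abbreviation noms1 :: "('p, 'n, 'm) form \<Rightarrow> 'n set" where "noms1 \<equiv> set2_form"
abbreviation noms2 :: "('p, 'n, 'm) form \<Rightarrow> 'm set" where "noms2 \<equiv> set3_form"

section \<open>Dependent product models\<close>

record ('w1, 'w2, 'p, 'n, 'm) dmodel =
  W1 :: "'w1 set"
  R1 :: "('w1 \<times> 'w1) set"
  W2 :: "'w2 set"
  R2 :: "'w1 \<Rightarrow> ('w2 \<times> 'w2) set"
  VP :: "'p \<Rightarrow> ('w1 \<times> 'w2) set"
  VN1 :: "'n \<Rightarrow> ('w1 \<times> 'w2) set"
  VN2 :: "'m \<Rightarrow> ('w1 \<times> 'w2) set"

definition points :: "('w1, 'w2, 'p, 'n, 'm) dmodel \<Rightarrow> ('w1 \<times> 'w2) set" where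
  "points M = W1 M \<times> W2 M"

definition Rh :: "('w1, 'w2, 'p, 'n, 'm) dmodel \<Rightarrow> (('w1 \<times> 'w2) \<times> ('w1 \<times> 'w2)) set" where
  "Rh M = {((x, y), (x', y')). (x, y) \<in> points M \<and> (x', y') \<in> points M \<and> (x, x') \<in> R1 M \<and> y = y'}"

definition Rv :: "('w1, 'w2, 'p, 'n, 'm) dmodel \<Rightarrow> (('w1 \<times> 'w2) \<times> ('w1 \<times> 'w2)) set" where
  "Rv M = {((x, y), (x', y')). (x, y) \<in> points M \<and> (x', y') \<in> points M \<and> x = x' \<and> (y, y') \<in> R2 M x}"

definition dproduct_model :: "('w1, 'w2, 'p, 'n, 'm) dmodel \<Rightarrow> bool" where
  "dproduct_model M \<longleftrightarrow>
     W1 M \<noteq> {} \<and> countable (W1 M) \<and> R1 M \<subseteq> W1 M \<times> W1 M \<and>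
     W2 M \<noteq> {} \<and> countable (W2 M) \<and> (\<forall>x\<in>W1 M. R2 M x \<subseteq> W2 M \<times> W2 M) \<and>
     (\<forall>p. VP M p \<subseteq> points M) \<and>
     (\<forall>i. \<exists>x\<in>W1 M. VN1 M i = {x} \<times> W2 M) \<and>
     (\<forall>a. \<exists>y\<in>W2 M. VN2 M a = W1 M \<times> {y})"

definition den1 :: "('w1, 'w2, 'p, 'n, 'm) dmodel \<Rightarrow> 'n \<Rightarrow> 'w1" where
  "den1 M i = (THE x. x \<in> W1 M \<and> VN1 M i = {x} \<times> W2 M)"

definition den2 :: "('w1, 'w2, 'p, 'n, 'm) dmodel \<Rightarrow> 'm \<Rightarrow> 'w2" where
  "den2 M a = (THE y. y \<in> W2 M \<and> VN2 M a = W1 M \<times> {y})"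

primrec sat :: "('w1, 'w2, 'p, 'n, 'm) dmodel \<Rightarrow> 'w1 \<times> 'w2 \<Rightarrow> ('p, 'n, 'm) form \<Rightarrow> bool" where
  "sat M w (Pro p) \<longleftrightarrow> w \<in> VP M p"
| "sat M w (Nom1 i) \<longleftrightarrow> fst w = den1 M i"
| "sat M w (Nom2 a) \<longleftrightarrow> snd w = den2 M a"
| "sat M w (Neg \<phi>) \<longleftrightarrow> \<not> sat M w \<phi>"
| "sat M w (Con \<phi> \<psi>) \<longleftrightarrow> sat M w \<phi> \<and> sat M w \<psi>"
| "sat M w (Dia1 \<phi>) \<longleftrightarrow> (\<exists>w'. (w, w') \<in> Rh M \<and> sat M w' \<phi>)"
| "sat M w (Dia2 \<phi>) \<longleftrightarrow> (\<exists>w'. (w, w') \<in> Rv M \<and> sat M w' \<phi>)"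
| "sat M w (At1 i \<phi>) \<longleftrightarrow> sat M (den1 M i, snd w) \<phi>"
| "sat M w (At2 a \<phi>) \<longleftrightarrow> sat M (fst w, den2 M a) \<phi>"

text \<open>HOL cannot quantify over types inside a formula. Both components of a d-product frame are
  countable, so each d-product model is isomorphic to one whose carriers are sets of natural
  numbers, and quantifying over the latter loses nothing.\<close>

definition valid :: "('p, 'n, 'm) form \<Rightarrow> bool" where
  "valid \<phi> \<longleftrightarrow>
     (\<forall>M :: (nat, nat, 'p, 'n, 'm) dmodel. dproduct_model M \<longrightarrow> (\<forall>w\<in>points M. sat M w \<phi>))"

section \<open>Tableau rules\<close>

text \<open>The names of the two diamond rules carry the new nominal that they introduce.\<close>

datatype ('n, 'm) rule_name =
    NegNeg | Conj | NegConj
  | Diamond1 'n | Diamond2 'm | NegDiamond1 | NegDiamond2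
  | Sat1 | Sat2 | NegSat1 | NegSat2
  | Red1 | Red2 | NegNom1 | NegNom2
  | Id1 | Id2 | Id1' | Id2'

definition lit1 :: "('p, 'n, 'm) form \<Rightarrow> bool" where
  "lit1 s \<longleftrightarrow> (\<exists>k. s = Nom1 k \<or> s = Neg (Nom1 k))"

definition lit2 :: "('p, 'n, 'm) form \<Rightarrow> bool" where
  "lit2 t \<longleftrightarrow> (\<exists>c. t = Nom2 c \<or> t = Neg (Nom2 c))"

text \<open>\<open>rule r ps alts\<close>: rule \<open>r\<close> has an instance with premises \<open>ps\<close>, splitting the branch into one
  extension for each element of \<open>alts\<close>, which lists the formulas added. The side conditions,
  which depend on the branch, are imposed separately below.\<close>

inductive rule ::
  "('n, 'm) rule_name \<Rightarrow> ('p, 'n, 'm) form list \<Rightarrow> ('p, 'n, 'm) form list list \<Rightarrow> bool" where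
  "rule NegNeg [At12 i a (Neg (Neg \<phi>))] [[At12 i a \<phi>]]"
| "rule Conj [At12 i a (Con \<phi> \<psi>)] [[At12 i a \<phi>, At12 i a \<psi>]]"
| "rule NegConj [At12 i a (Neg (Con \<phi> \<psi>))] [[At12 i a (Neg \<phi>)], [At12 i a (Neg \<psi>)]]"
| "rule (Diamond1 j) [At12 i a (Dia1 \<phi>)] [[At1 i (Dia1 (Nom1 j)), At12 j a \<phi>]]"
| "rule (Diamond2 b) [At12 i a (Dia2 \<phi>)] [[At12 i a (Dia2 (Nom2 b)), At12 i b \<phi>]]"
| "rule NegDiamond1 [At12 i a (Neg (Dia1 \<phi>)), At1 i (Dia1 (Nom1 j))] [[At12 j a (Neg \<phi>)]]"
| "rule NegDiamond2 [At12 i a (Neg (Dia2 \<phi>)), At12 i a (Dia2 (Nom2 b))] [[At12 i b (Neg \<phi>)]]"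
| "rule Sat1 [At12 i a (At1 j \<phi>)] [[At12 j a \<phi>]]"
| "rule Sat2 [At12 i a (At2 b \<phi>)] [[At12 i b \<phi>]]"
| "rule NegSat1 [At12 i a (Neg (At1 j \<phi>))] [[At12 j a (Neg \<phi>)]]"
| "rule NegSat2 [At12 i a (Neg (At2 b \<phi>))] [[At12 i b (Neg \<phi>)]]"
| "lit1 s \<Longrightarrow> rule Red1 [At12 i a s] [[At1 i s]]"
| "lit2 t \<Longrightarrow> rule Red2 [At12 i a t] [[At2 a t]]"
| "rule NegNom1 [At1 i (Neg (Nom1 j))] [[At1 j (Nom1 j)]]"
| "rule NegNom2 [At2 a (Neg (Nom2 b))] [[At2 b (Nom2 b)]]"
| "rule Id1 [At12 i a \<phi>, At1 i (Nom1 j)] [[At12 j a \<phi>]]"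
| "rule Id2 [At12 i a \<phi>, At2 a (Nom2 b)] [[At12 i b \<phi>]]"
| "lit1 s \<Longrightarrow> rule Id1' [At1 i s, At1 i (Nom1 j)] [[At1 j s]]"
| "lit2 t \<Longrightarrow> rule Id2' [At2 a t, At2 a (Nom2 b)] [[At2 b t]]"

definition is_diamond_rule :: "('n, 'm) rule_name \<Rightarrow> bool" where
  "is_diamond_rule r \<longleftrightarrow> (\<exists>j. r = Diamond1 j) \<or> (\<exists>b. r = Diamond2 b)"

definition restricted_rule :: "('n, 'm) rule_name \<Rightarrow> bool" where
  "restricted_rule r \<longleftrightarrow> (\<exists>b. r = Diamond2 b) \<or> r = Id1 \<or> r = Id2"

section \<open>Tableaux\<close>

text \<open>A tree is given by the labels of its nodes. A node is addressed by the sequence of child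
  numbers leading to it from the root, so that every node is at finite depth, while branches may
  be infinite. Each node other than the root comes from one rule application: it records the
  rule, its premises, and the formulas which that application adds to the branch through the node.\<close>

datatype ('p, 'n, 'm) node_label =
    Start "('p, 'n, 'm) form"
  | Apply "('n, 'm) rule_name" "('p, 'n, 'm) form list" "('p, 'n, 'm) form list"

primrec added :: "('p, 'n, 'm) node_label \<Rightarrow> ('p, 'n, 'm) form list" where
  "added (Start \<phi>) = [\<phi>]"
| "added (Apply r ps fs) = fs"

type_synonym ('p, 'n, 'm) tree = "nat list \<Rightarrow> ('p, 'n, 'm) node_label option"

definition path :: "('p, 'n, 'm) tree \<Rightarrow> nat list set \<Rightarrow> bool" where
  "path T B \<longleftrightarrow> B \<subseteq> dom T \<and> (\<forall>u\<in>B. \<forall>v\<in>B. prefix u v \<or> prefix v u)"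

definition branch :: "('p, 'n, 'm) tree \<Rightarrow> nat list set \<Rightarrow> bool" where
  "branch T B \<longleftrightarrow> path T B \<and> (\<forall>C. path T C \<and> B \<subseteq> C \<longrightarrow> C = B)"

definition path_to :: "nat list \<Rightarrow> nat list set" where
  "path_to u = {v. prefix v u}"

text \<open>In the following, \<open>B\<close> is a branch or the path from the root to some node.\<close>

definition forms :: "('p, 'n, 'm) tree \<Rightarrow> nat list set \<Rightarrow> ('p, 'n, 'm) form set" where
  "forms T B = {\<phi>. \<exists>u\<in>B. \<exists>l. T u = Some l \<and> \<phi> \<in> set (added l)}"

definition accessibility :: "('p, 'n, 'm) tree \<Rightarrow> nat list set \<Rightarrow> ('p, 'n, 'm) form set" where
  "accessibility T B = {\<phi>. \<exists>u\<in>B. \<exists>b ps \<psi>. T u = Some (Apply (Diamond2 b) ps [\<phi>, \<psi>])}"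

definition closed_branch :: "('p, 'n, 'm) tree \<Rightarrow> nat list set \<Rightarrow> bool" where
  "closed_branch T B \<longleftrightarrow>
     (\<exists>\<phi> i a. At12 i a \<phi> \<in> forms T B \<and> At12 i a (Neg \<phi>) \<in> forms T B) \<or>
     (\<exists>\<phi> i. At1 i \<phi> \<in> forms T B \<and> At1 i (Neg \<phi>) \<in> forms T B) \<or>
     (\<exists>\<phi> a. At2 a \<phi> \<in> forms T B \<and> At2 a (Neg \<phi>) \<in> forms T B)"

definition premises_available ::
  "('p, 'n, 'm) tree \<Rightarrow> nat list set \<Rightarrow> ('n, 'm) rule_name \<Rightarrow> ('p, 'n, 'm) form list \<Rightarrow> bool" where
  "premises_available T B r ps \<longleftrightarrow>
     set ps \<subseteq> forms T B \<and> (restricted_rule r \<longrightarrow> set ps \<inter> accessibility T B = {})"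

text \<open>A rule instance has nothing left to contribute to a branch if one of its alternatives is
  already there. The diamond rules are instead applied once per formula: no instance
  contributes, whatever its new nominal, once the rule has been applied to that premise.\<close>

definition fulfilled ::
  "('p, 'n, 'm) tree \<Rightarrow> nat list set \<Rightarrow> ('n, 'm) rule_name \<Rightarrow> ('p, 'n, 'm) form list \<Rightarrow>
   ('p, 'n, 'm) form list list \<Rightarrow> bool" where
  "fulfilled T B r ps alts \<longleftrightarrow>
     (if is_diamond_rule r
      then \<exists>u\<in>B. \<exists>r' fs. T u = Some (Apply r' ps fs) \<and> is_diamond_rule r'
      else \<exists>fs\<in>set alts. set fs \<subseteq> forms T B)"

definition new_nominal ::
  "('p, 'n, 'm) tree \<Rightarrow> nat list set \<Rightarrow> ('n, 'm) rule_name \<Rightarrow> bool" where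
  "new_nominal T B r \<longleftrightarrow>
     (case r of
        Diamond1 j \<Rightarrow> j \<notin> (\<Union>\<phi>\<in>forms T B. noms1 \<phi>)
      | Diamond2 b \<Rightarrow> b \<notin> (\<Union>\<phi>\<in>forms T B. noms2 \<phi>)
      | _ \<Rightarrow> True)"

definition expanded_by ::
  "('p, 'n, 'm) tree \<Rightarrow> nat list \<Rightarrow> ('n, 'm) rule_name \<Rightarrow> ('p, 'n, 'm) form list \<Rightarrow>
   ('p, 'n, 'm) form list list \<Rightarrow> bool" where
  "expanded_by T u r ps alts \<longleftrightarrow>
     rule r ps alts \<and> premises_available T (path_to u) r ps \<and>
     \<not> fulfilled T (path_to u) r ps alts \<and> new_nominal T (path_to u) r \<and>
     (\<forall>k. T (u @ [k]) = (if k < length alts then Some (Apply r ps (alts ! k)) else None))"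

text \<open>No freshness condition here: an infinite branch may use up all nominals, but it must
  nevertheless contain an application of the diamond rules to each of its diamond formulas.\<close>

definition saturated :: "('p, 'n, 'm) tree \<Rightarrow> nat list set \<Rightarrow> bool" where
  "saturated T B \<longleftrightarrow>
     (\<forall>r ps alts. rule r ps alts \<and> premises_available T B r ps \<longrightarrow> fulfilled T B r ps alts)"

definition tableau :: "('p, 'n, 'm) form \<Rightarrow> ('p, 'n, 'm) tree \<Rightarrow> bool" where
  "tableau \<chi> T \<longleftrightarrow>
     T [] = Some (Start \<chi>) \<and>
     (\<forall>u k. u @ [k] \<in> dom T \<longrightarrow> u \<in> dom T) \<and>
     (\<forall>u\<in>dom T. (\<forall>k. T (u @ [k]) = None) \<or>
        \<not> closed_branch T (path_to u) \<and> (\<exists>r ps alts. expanded_by T u r ps alts)) \<and>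
     (\<forall>B. branch T B \<longrightarrow> closed_branch T B \<or> saturated T B)"

definition closed_tableau :: "('p, 'n, 'm) form \<Rightarrow> ('p, 'n, 'm) tree \<Rightarrow> bool" where
  "closed_tableau \<chi> T \<longleftrightarrow> tableau \<chi> T \<and> (\<forall>B. branch T B \<longrightarrow> closed_branch T B)"

definition provable :: "('p, 'n, 'm) form \<Rightarrow> bool" where
  "provable \<phi> \<longleftrightarrow>
     (\<exists>i a T. i \<notin> noms1 \<phi> \<and> a \<notin> noms2 \<phi> \<and> closed_tableau (At12 i a (Neg \<phi>)) T)"

end

theory Submission
  imports Defs
begin

text \<open>Completeness is proved by contraposition, from a fair tableau. The tableau applies at each
  open node the pending rule instance with the least code. An instance whose code has been dealt
  with never becomes pending again on the same branch, so that an instance cannot be postponed for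
  ever, and every open branch is saturated (\<open>open_branch_saturated\<close>). Hence, if \<open>\<phi>\<close> is not
  provable, the fair tableau for \<open>@\<^sub>i@\<^sub>a\<not>\<phi>\<close> has an open saturated branch, from which a
  model refuting \<open>\<phi>\<close> is read off.

  The points of this model are nominals, and the formulas \<open>@\<^sub>ij\<close> on the branch say which of them
  have to be identified. The rule \<open>Id\<^sub>1'\<close> makes this relation Euclidean, but it need be neither
  reflexive nor symmetric: only on the nominals that occur on its right-hand side is it an
  equivalence. So each
  nominal \<open>i\<close> is sent to a chosen representative \<open>rep i\<close>, which is \<open>i\<close> itself if there is no
  \<open>@\<^sub>ij\<close>. The rules \<open>Id\<^sub>1\<close> and \<open>Id\<^sub>2\<close> copy each formula \<open>@\<^sub>i@\<^sub>a\<psi>\<close> to the representatives of \<open>i\<close>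
  and \<open>a\<close>, where the other rules then apply; therefore the accessibility relations of the
  model only record the arrows that start at representatives (\<open>truth\<close>).

  Accessibility formulas are not copied. They do not matter to the truth lemma: the nominal
  below the diamond of an accessibility formula is fresh, hence differs from those of the
  root formula, and the truth lemma is only about formulas \<open>@\<^sub>i@\<^sub>a\<psi>\<close> where every nominal of the second
  sort in \<open>\<psi>\<close> occurs in the root formula. This class is closed under passing to subformulas.\<close>

section \<open>Representatives for a Euclidean relation\<close>

definition euclidean :: "('a \<Rightarrow> 'a \<Rightarrow> bool) \<Rightarrow> bool" where
  "euclidean E \<longleftrightarrow> (\<forall>i j k. E i j \<longrightarrow> E i k \<longrightarrow> E j k)"

text \<open>The successors of \<open>i\<close> are pairwise related, but not every nominal equivalent to one of them
  need be a successor of \<open>i\<close>. Two steps reach the whole equivalence class, which makes the choice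
  agree for \<open>i\<close> and its successors.\<close>

definition rep :: "('a \<Rightarrow> 'a \<Rightarrow> bool) \<Rightarrow> 'a \<Rightarrow> 'a" where
  "rep E i = (if \<exists>j. E i j then SOME j. \<exists>k. E i k \<and> E k j else i)"

lemma rep_eq:
  assumes "euclidean E" and "E i j"
  shows "rep E i = rep E j"
proof -
  have "(\<exists>k. E i k \<and> E k l) \<longleftrightarrow> (\<exists>k. E j k \<and> E k l)" for l
    using assms unfolding euclidean_def by metis
  moreover have "\<exists>k. E j k"
    using assms unfolding euclidean_def by blast
  ultimately show ?thesis
    using \<open>E i j\<close> unfolding rep_def by auto
qed

lemma rep_two_steps:
  assumes "euclidean E" and "E i j"
  shows "\<exists>k. E i k \<and> E k (rep E i)"
proof -
  have "\<exists>l k. E i k \<and> E k l"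
    using assms unfolding euclidean_def by blast
  then have "\<exists>k. E i k \<and> E k (SOME l. \<exists>k. E i k \<and> E k l)"
    by (rule someI_ex)
  then show ?thesis
    using \<open>E i j\<close> unfolding rep_def by auto
qed

lemma rep_invariant:
  assumes "euclidean E" and step: "\<And>j k. P j \<Longrightarrow> E j k \<Longrightarrow> P k" and "P i"
  shows "P (rep E i)"
proof (cases "\<exists>j. E i j")
  case True
  then obtain k where "E i k" "E k (rep E i)"
    using rep_two_steps[OF \<open>euclidean E\<close>] by blast
  then show ?thesis
    using step[of i k] step[of k "rep E i"] \<open>P i\<close> by blast
next
  case False
  then show ?thesis
    using \<open>P i\<close> by (simp add: rep_def)
qed

lemma rep_rep:
  assumes "euclidean E"
  shows "rep E (rep E i) = rep E i"
proof (rule rep_invariant[where P = "\<lambda>j. rep E j = rep E i", OF assms])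
  show "rep E k = rep E i" if "rep E j = rep E i" "E j k" for j k
    using that rep_eq[OF assms, of j k] by simp
qed simp

text \<open>\<open>D i k\<close> stands for \<open>@\<^sub>i\<not>k\<close>. The rule that adds \<open>@\<^sub>kk\<close> is what puts \<open>k\<close> among the nominals
  on which \<open>E\<close> is an equivalence; only then does a common representative of \<open>i\<close> and \<open>k\<close> lead
  from \<open>i\<close> back to \<open>k\<close>, and so to a contradiction.\<close>

lemma rep_neq:
  assumes "euclidean E"
    and transfer: "\<And>i j. D i k \<Longrightarrow> E i j \<Longrightarrow> D j k"
    and "E k k"
    and consistent: "\<And>i. D i k \<Longrightarrow> \<not> E i k"
    and "D i k"
  shows "rep E i \<noteq> rep E k"
proof
  assume eq: "rep E i = rep E k"
  have "E (rep E k) k"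
    using rep_two_steps[OF \<open>euclidean E\<close> \<open>E k k\<close>] \<open>E k k\<close> \<open>euclidean E\<close>
    unfolding euclidean_def by metis
  moreover have "D (rep E i) k"
    using rep_invariant[where P = "\<lambda>j. D j k", OF \<open>euclidean E\<close> transfer \<open>D i k\<close>] .
  ultimately show False
    using consistent[of "rep E i"] eq by simp
qed

section \<open>A model from a saturated set\<close>

text \<open>What saturation and openness say about the formulas \<open>\<Theta>\<close> of a branch. In the
  conditions for the restricted rules, \<open>N\<close> stands for the second-sort nominals of the root formula:
  no formula \<open>@\<^sub>i@\<^sub>a\<phi>\<close> with \<open>noms2 \<phi> \<subseteq> N\<close> is an accessibility formula.\<close>

locale hintikka =
  fixes \<Theta> :: "('p, 'n::countable, 'm::countable) form set" and N :: "'m set"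
  assumes neg_neg: "At12 i a (Neg (Neg \<phi>)) \<in> \<Theta> \<Longrightarrow> At12 i a \<phi> \<in> \<Theta>"
    and con: "At12 i a (Con \<phi> \<psi>) \<in> \<Theta> \<Longrightarrow> At12 i a \<phi> \<in> \<Theta> \<and> At12 i a \<psi> \<in> \<Theta>"
    and neg_con: "At12 i a (Neg (Con \<phi> \<psi>)) \<in> \<Theta> \<Longrightarrow> At12 i a (Neg \<phi>) \<in> \<Theta> \<or> At12 i a (Neg \<psi>) \<in> \<Theta>"
    and dia1: "At12 i a (Dia1 \<phi>) \<in> \<Theta> \<Longrightarrow> \<exists>j. At1 i (Dia1 (Nom1 j)) \<in> \<Theta> \<and> At12 j a \<phi> \<in> \<Theta>"
    and dia2: "At12 i a (Dia2 \<phi>) \<in> \<Theta> \<Longrightarrow> noms2 \<phi> \<subseteq> N \<Longrightarrow>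
      \<exists>b. At12 i a (Dia2 (Nom2 b)) \<in> \<Theta> \<and> At12 i b \<phi> \<in> \<Theta>"
    and neg_dia1: "At12 i a (Neg (Dia1 \<phi>)) \<in> \<Theta> \<Longrightarrow> At1 i (Dia1 (Nom1 j)) \<in> \<Theta> \<Longrightarrow> At12 j a (Neg \<phi>) \<in> \<Theta>"
    and neg_dia2: "At12 i a (Neg (Dia2 \<phi>)) \<in> \<Theta> \<Longrightarrow> At12 i a (Dia2 (Nom2 b)) \<in> \<Theta> \<Longrightarrow>
      At12 i b (Neg \<phi>) \<in> \<Theta>"
    and at1: "At12 i a (At1 j \<phi>) \<in> \<Theta> \<Longrightarrow> At12 j a \<phi> \<in> \<Theta>"
    and at2: "At12 i a (At2 b \<phi>) \<in> \<Theta> \<Longrightarrow> At12 i b \<phi> \<in> \<Theta>"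
    and neg_at1: "At12 i a (Neg (At1 j \<phi>)) \<in> \<Theta> \<Longrightarrow> At12 j a (Neg \<phi>) \<in> \<Theta>"
    and neg_at2: "At12 i a (Neg (At2 b \<phi>)) \<in> \<Theta> \<Longrightarrow> At12 i b (Neg \<phi>) \<in> \<Theta>"
    and red1: "lit1 s \<Longrightarrow> At12 i a s \<in> \<Theta> \<Longrightarrow> At1 i s \<in> \<Theta>"
    and red2: "lit2 t \<Longrightarrow> At12 i a t \<in> \<Theta> \<Longrightarrow> At2 a t \<in> \<Theta>"
    and neg_nom1: "At1 i (Neg (Nom1 j)) \<in> \<Theta> \<Longrightarrow> At1 j (Nom1 j) \<in> \<Theta>"
    and neg_nom2: "At2 a (Neg (Nom2 b)) \<in> \<Theta> \<Longrightarrow> At2 b (Nom2 b) \<in> \<Theta>"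
    and id1: "At12 i a \<phi> \<in> \<Theta> \<Longrightarrow> noms2 \<phi> \<subseteq> N \<Longrightarrow> At1 i (Nom1 j) \<in> \<Theta> \<Longrightarrow> At12 j a \<phi> \<in> \<Theta>"
    and id2: "At12 i a \<phi> \<in> \<Theta> \<Longrightarrow> noms2 \<phi> \<subseteq> N \<Longrightarrow> At2 a (Nom2 b) \<in> \<Theta> \<Longrightarrow> At12 i b \<phi> \<in> \<Theta>"
    and id1': "lit1 s \<Longrightarrow> At1 i s \<in> \<Theta> \<Longrightarrow> At1 i (Nom1 j) \<in> \<Theta> \<Longrightarrow> At1 j s \<in> \<Theta>"
    and id2': "lit2 t \<Longrightarrow> At2 a t \<in> \<Theta> \<Longrightarrow> At2 a (Nom2 b) \<in> \<Theta> \<Longrightarrow> At2 b t \<in> \<Theta>"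
    and consistent: "At12 i a \<phi> \<in> \<Theta> \<Longrightarrow> At12 i a (Neg \<phi>) \<notin> \<Theta>"
    and consistent1: "At1 i \<phi> \<in> \<Theta> \<Longrightarrow> At1 i (Neg \<phi>) \<notin> \<Theta>"
    and consistent2: "At2 a \<phi> \<in> \<Theta> \<Longrightarrow> At2 a (Neg \<phi>) \<notin> \<Theta>"
begin

definition same1 :: "'n \<Rightarrow> 'n \<Rightarrow> bool" where "same1 i j \<longleftrightarrow> At1 i (Nom1 j) \<in> \<Theta>"
definition same2 :: "'m \<Rightarrow> 'm \<Rightarrow> bool" where "same2 a b \<longleftrightarrow> At2 a (Nom2 b) \<in> \<Theta>"

abbreviation rep1 :: "'n \<Rightarrow> 'n" where "rep1 \<equiv> rep same1"
abbreviation rep2 :: "'m \<Rightarrow> 'm" where "rep2 \<equiv> rep same2"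

definition pt1 :: "'n \<Rightarrow> nat" where "pt1 i = to_nat (rep1 i)"
definition pt2 :: "'m \<Rightarrow> nat" where "pt2 a = to_nat (rep2 a)"

text \<open>The diamond rules and their negations meet only at representatives, so arrows recorded at
  other nominals must be left out: a formula \<open>@\<^sub>i@\<^sub>a\<not>\<diamond>\<^sub>1\<phi>\<close> need not reach a nominal \<open>i'\<close>
  that merely has the same representative as \<open>i\<close>.\<close>

definition canonical :: "(nat, nat, 'p, 'n, 'm) dmodel" where
  "canonical = \<lparr>
     W1 = range pt1,
     R1 = {(pt1 i, pt1 j) | i j. At1 (rep1 i) (Dia1 (Nom1 j)) \<in> \<Theta>},
     W2 = range pt2,
     R2 = (\<lambda>x. {(pt2 a, pt2 b) | i a b. x = pt1 i \<and> At12 (rep1 i) (rep2 a) (Dia2 (Nom2 b)) \<in> \<Theta>}),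
     VP = (\<lambda>p. {(pt1 i, pt2 a) | i a. At12 (rep1 i) (rep2 a) (Pro p) \<in> \<Theta>}),
     VN1 = (\<lambda>i. {pt1 i} \<times> range pt2),
     VN2 = (\<lambda>a. range pt1 \<times> {pt2 a})\<rparr>"

lemma euclidean1: "euclidean same1"
  unfolding euclidean_def
proof (intro allI impI)
  fix i j k assume "same1 i j" "same1 i k"
  then show "same1 j k"
    using id1'[of "Nom1 k" i j] by (simp add: same1_def lit1_def)
qed

lemma euclidean2: "euclidean same2"
  unfolding euclidean_def
proof (intro allI impI)
  fix a b c assume "same2 a b" "same2 a c"
  then show "same2 b c"
    using id2'[of "Nom2 c" a b] by (simp add: same2_def lit2_def)
qed

lemma pt1_eq_iff: "pt1 i = pt1 j \<longleftrightarrow> rep1 i = rep1 j"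
  by (simp add: pt1_def)

lemma pt2_eq_iff: "pt2 a = pt2 b \<longleftrightarrow> rep2 a = rep2 b"
  by (simp add: pt2_def)

lemma pt1_rep1 [simp]: "pt1 (rep1 i) = pt1 i"
  using rep_rep[OF euclidean1] by (simp add: pt1_def)

lemma pt2_rep2 [simp]: "pt2 (rep2 a) = pt2 a"
  using rep_rep[OF euclidean2] by (simp add: pt2_def)

lemma dproduct_model_canonical: "dproduct_model canonical"
  by (auto simp: dproduct_model_def canonical_def points_def)

lemma den1_canonical [simp]: "den1 canonical i = pt1 i"
  unfolding den1_def canonical_def by (rule the_equality) (auto simp: times_eq_iff)

lemma den2_canonical [simp]: "den2 canonical a = pt2 a"
  unfolding den2_def canonical_def by (rule the_equality) (auto simp: times_eq_iff)

lemma canonical_pro_iff: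
  "(pt1 i, pt2 a) \<in> VP canonical p \<longleftrightarrow> At12 (rep1 i) (rep2 a) (Pro p) \<in> \<Theta>"
  by (auto simp: canonical_def pt1_eq_iff pt2_eq_iff)

lemma canonical_Rh_iff:
  "((pt1 i, pt2 a), w) \<in> Rh canonical \<longleftrightarrow>
     (\<exists>j. w = (pt1 j, pt2 a) \<and> At1 (rep1 i) (Dia1 (Nom1 j)) \<in> \<Theta>)"
  by (cases w) (auto simp: Rh_def points_def canonical_def pt1_eq_iff; metis)

lemma canonical_Rv_iff:
  "((pt1 i, pt2 a), w) \<in> Rv canonical \<longleftrightarrow>
     (\<exists>b. w = (pt1 i, pt2 b) \<and> At12 (rep1 i) (rep2 a) (Dia2 (Nom2 b)) \<in> \<Theta>)"
  by (cases w) (auto simp: Rv_def points_def canonical_def pt1_eq_iff pt2_eq_iff; metis)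

lemma at_reps:
  assumes "At12 i a \<phi> \<in> \<Theta>" and "noms2 \<phi> \<subseteq> N"
  shows "At12 (rep1 i) (rep2 a) \<phi> \<in> \<Theta>"
proof -
  have "At12 (rep1 i) a \<phi> \<in> \<Theta>"
    using rep_invariant[where P = "\<lambda>i. At12 i a \<phi> \<in> \<Theta>", OF euclidean1 _ assms(1)]
      id1[OF _ assms(2)] unfolding same1_def by blast
  then show ?thesis
    using rep_invariant[where P = "\<lambda>a. At12 (rep1 i) a \<phi> \<in> \<Theta>", OF euclidean2]
      id2[OF _ assms(2)] unfolding same2_def by blast
qed

lemma same_pt1:
  assumes "At12 i a (Nom1 k) \<in> \<Theta>" shows "pt1 i = pt1 k"
  using red1[OF _ assms] rep_eq[OF euclidean1, of i k]
  by (auto simp: pt1_eq_iff same1_def lit1_def)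

lemma same_pt2:
  assumes "At12 i a (Nom2 c) \<in> \<Theta>" shows "pt2 a = pt2 c"
  using red2[OF _ assms] rep_eq[OF euclidean2, of a c]
  by (auto simp: pt2_eq_iff same2_def lit2_def)

lemma different_pt1:
  assumes "At12 i a (Neg (Nom1 k)) \<in> \<Theta>" shows "pt1 i \<noteq> pt1 k"
proof -
  have *: "At1 i (Neg (Nom1 k)) \<in> \<Theta>"
    using red1[OF _ assms] by (simp add: lit1_def)
  show ?thesis
    unfolding pt1_eq_iff
  proof (rule rep_neq[where D = "\<lambda>i k. At1 i (Neg (Nom1 k)) \<in> \<Theta>", OF euclidean1 _ _ _ *])
    show "same1 k k"
      using neg_nom1[OF *] by (simp add: same1_def)
    show "At1 j (Neg (Nom1 k)) \<in> \<Theta>"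
      if "At1 j' (Neg (Nom1 k)) \<in> \<Theta>" "same1 j' j" for j' j
      using id1'[of "Neg (Nom1 k)" j' j] that by (simp add: same1_def lit1_def)
    show "\<not> same1 j k" if "At1 j (Neg (Nom1 k)) \<in> \<Theta>" for j
      using consistent1[of j "Nom1 k"] that by (auto simp: same1_def)
  qed
qed

lemma different_pt2:
  assumes "At12 i a (Neg (Nom2 c)) \<in> \<Theta>" shows "pt2 a \<noteq> pt2 c"
proof -
  have *: "At2 a (Neg (Nom2 c)) \<in> \<Theta>"
    using red2[OF _ assms] by (simp add: lit2_def)
  show ?thesis
    unfolding pt2_eq_iff
  proof (rule rep_neq[where D = "\<lambda>a c. At2 a (Neg (Nom2 c)) \<in> \<Theta>", OF euclidean2 _ _ _ *])
    show "same2 c c"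
      using neg_nom2[OF *] by (simp add: same2_def)
    show "At2 b (Neg (Nom2 c)) \<in> \<Theta>"
      if "At2 b' (Neg (Nom2 c)) \<in> \<Theta>" "same2 b' b" for b' b
      using id2'[of "Neg (Nom2 c)" b' b] that by (simp add: same2_def lit2_def)
    show "\<not> same2 b c" if "At2 b (Neg (Nom2 c)) \<in> \<Theta>" for b
      using consistent2[of b "Nom2 c"] that by (auto simp: same2_def)
  qed
qed

text \<open>By induction on \<open>\<phi>\<close>; the claim about \<open>\<not>\<phi>\<close> has to be carried along because the calculus has
  its own rule for each negated connective. For propositional variables and diamonds
  the formula is first moved to the representatives.\<close>

lemma truth:
  assumes "noms2 \<phi> \<subseteq> N"
  shows "(At12 i a \<phi> \<in> \<Theta> \<longrightarrow> sat canonical (pt1 i, pt2 a) \<phi>) \<and>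
    (At12 i a (Neg \<phi>) \<in> \<Theta> \<longrightarrow> \<not> sat canonical (pt1 i, pt2 a) \<phi>)"
  using assms
proof (induction \<phi> arbitrary: i a)
  case (Pro p)
  then show ?case
    using at_reps[of i a "Pro p"] at_reps[of i a "Neg (Pro p)"] consistent
    by (auto simp: canonical_pro_iff)
next
  case (Nom1 k)
  then show ?case
    using same_pt1[of i a k] different_pt1[of i a k] by auto
next
  case (Nom2 c)
  then show ?case
    using same_pt2[of i a c] different_pt2[of i a c] by auto
next
  case (Neg \<phi>)
  then show ?case
    using neg_neg[of i a \<phi>] Neg.IH[of i a] by auto
next
  case (Con \<phi> \<psi>)
  then show ?case
    using con[of i a \<phi> \<psi>] neg_con[of i a \<phi> \<psi>] Con.IH[of i a] by auto
next
  case (Dia1 \<phi>)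
  show ?case
  proof (intro conjI impI)
    assume "At12 i a (Dia1 \<phi>) \<in> \<Theta>"
    then have "At12 (rep1 i) (rep2 a) (Dia1 \<phi>) \<in> \<Theta>"
      using at_reps Dia1.prems by blast
    then obtain j where "At1 (rep1 i) (Dia1 (Nom1 j)) \<in> \<Theta>" "At12 j (rep2 a) \<phi> \<in> \<Theta>"
      using dia1 by blast
    then show "sat canonical (pt1 i, pt2 a) (Dia1 \<phi>)"
      using Dia1.IH[of j "rep2 a"] Dia1.prems by (auto simp: canonical_Rh_iff)
  next
    assume "At12 i a (Neg (Dia1 \<phi>)) \<in> \<Theta>"
    then have "At12 (rep1 i) (rep2 a) (Neg (Dia1 \<phi>)) \<in> \<Theta>"
      using at_reps Dia1.prems by auto
    then have "At12 j (rep2 a) (Neg \<phi>) \<in> \<Theta>" if "At1 (rep1 i) (Dia1 (Nom1 j)) \<in> \<Theta>" for j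
      using neg_dia1 that by blast
    then show "\<not> sat canonical (pt1 i, pt2 a) (Dia1 \<phi>)"
      using Dia1.IH[of _ "rep2 a"] Dia1.prems by (auto simp: canonical_Rh_iff)
  qed
next
  case (Dia2 \<phi>)
  show ?case
  proof (intro conjI impI)
    assume "At12 i a (Dia2 \<phi>) \<in> \<Theta>"
    then have "At12 (rep1 i) (rep2 a) (Dia2 \<phi>) \<in> \<Theta>"
      using at_reps Dia2.prems by blast
    then obtain b where "At12 (rep1 i) (rep2 a) (Dia2 (Nom2 b)) \<in> \<Theta>" "At12 (rep1 i) b \<phi> \<in> \<Theta>"
      using dia2[of "rep1 i" "rep2 a" \<phi>] Dia2.prems by auto
    then show "sat canonical (pt1 i, pt2 a) (Dia2 \<phi>)"
      using Dia2.IH[of "rep1 i" b] Dia2.prems by (auto simp: canonical_Rv_iff)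
  next
    assume "At12 i a (Neg (Dia2 \<phi>)) \<in> \<Theta>"
    then have "At12 (rep1 i) (rep2 a) (Neg (Dia2 \<phi>)) \<in> \<Theta>"
      using at_reps Dia2.prems by auto
    then have "At12 (rep1 i) b (Neg \<phi>) \<in> \<Theta>"
      if "At12 (rep1 i) (rep2 a) (Dia2 (Nom2 b)) \<in> \<Theta>" for b
      using neg_dia2 that by blast
    then show "\<not> sat canonical (pt1 i, pt2 a) (Dia2 \<phi>)"
      using Dia2.IH[of "rep1 i"] Dia2.prems by (auto simp: canonical_Rv_iff)
  qed
next
  case (At1 j \<phi>)
  then show ?case
    using at1[of i a j \<phi>] neg_at1[of i a j \<phi>] At1.IH[of j a] by auto
next
  case (At2 b \<phi>)
  then show ?case
    using at2[of i a b \<phi>] neg_at2[of i a b \<phi>] At2.IH[of i b] by auto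
qed

lemma not_valid:
  assumes "At12 i a (Neg \<phi>) \<in> \<Theta>" and "noms2 \<phi> \<subseteq> N"
  shows "\<not> valid \<phi>"
proof -
  have "(pt1 i, pt2 a) \<in> points canonical"
    by (simp add: points_def canonical_def)
  moreover have "\<not> sat canonical (pt1 i, pt2 a) \<phi>"
    using truth assms by blast
  ultimately show ?thesis
    using dproduct_model_canonical by (auto simp: valid_def)
qed

end

section \<open>Monotonicity and finiteness along a path\<close>

instance form :: (countable, countable, countable) countable
  by countable_datatype

definition applicable ::
  "('p, 'n, 'm) tree \<Rightarrow> nat list set \<Rightarrow> ('n, 'm) rule_name \<Rightarrow> ('p, 'n, 'm) form list \<Rightarrow>
   ('p, 'n, 'm) form list list \<Rightarrow> bool" where
  "applicable T B r ps alts \<longleftrightarrow>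
     rule r ps alts \<and> premises_available T B r ps \<and> \<not> fulfilled T B r ps alts \<and> new_nominal T B r"

text \<open>What is pending at a node depends only on the tree along the path to it. This lets the
  tableau be built level by level.\<close>

lemma agree_cong:
  assumes "\<And>v. v \<in> B \<Longrightarrow> T v = T' v"
  shows "closed_branch T B = closed_branch T' B"
    and "applicable T B = applicable T' B"
proof -
  have forms: "forms T B = forms T' B"
    using assms by (auto simp: forms_def)
  show "closed_branch T B = closed_branch T' B"
    by (simp add: closed_branch_def forms)
  have "accessibility T B = accessibility T' B"
    using assms by (auto simp: accessibility_def)
  moreover have "fulfilled T B = fulfilled T' B"
    using assms by (auto simp: fulfilled_def fun_eq_iff forms)
  moreover have "new_nominal T B = new_nominal T' B"
    by (intro ext) (simp only: new_nominal_def forms)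
  ultimately show "applicable T B = applicable T' B"
    by (simp add: applicable_def premises_available_def forms fun_eq_iff)
qed

lemma forms_mono: "B \<subseteq> C \<Longrightarrow> forms T B \<subseteq> forms T C"
  by (auto simp: forms_def)

lemma accessibility_mono: "B \<subseteq> C \<Longrightarrow> accessibility T B \<subseteq> accessibility T C"
  by (auto simp: accessibility_def)

lemma closed_branch_mono: "B \<subseteq> C \<Longrightarrow> closed_branch T B \<Longrightarrow> closed_branch T C"
  unfolding closed_branch_def by (meson forms_mono subsetD)

lemma fulfilled_mono: "B \<subseteq> C \<Longrightarrow> fulfilled T B r ps alts \<Longrightarrow> fulfilled T C r ps alts"
  unfolding fulfilled_def by (cases "is_diamond_rule r"; simp) (meson forms_mono order_trans subsetD)+

lemma path_to_mono: "prefix u v \<Longrightarrow> path_to u \<subseteq> path_to v"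
  by (auto simp: path_to_def)

lemma finite_path_to: "finite (path_to u)"
proof -
  have "path_to u = set (prefixes u)"
    by (auto simp: path_to_def)
  then show ?thesis
    by simp
qed

lemma finite_forms:
  assumes "finite B"
  shows "finite (forms T B)"
proof -
  have "forms T B \<subseteq> (\<Union>u\<in>B. set (added (the (T u))))"
    by (force simp: forms_def)
  then show ?thesis
    using assms by (auto intro: finite_subset)
qed

lemma finite_noms1: "finite (noms1 \<phi>)"
  by (induction \<phi>) auto

lemma finite_noms2: "finite (noms2 \<phi>)"
  by (induction \<phi>) auto

lemma ex_fresh1:
  assumes "finite B"
  shows "\<exists>j::'n::infinite. new_nominal (T :: ('p, 'n, 'm) tree) B (Diamond1 j)"
  using ex_new_if_finite[OF infinite_UNIV, of "\<Union>\<phi>\<in>forms T B. noms1 \<phi>"] finite_forms[OF assms, of T]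
  by (auto simp: new_nominal_def finite_noms1)

lemma ex_fresh2:
  assumes "finite B"
  shows "\<exists>b::'m::infinite. new_nominal (T :: ('p, 'n, 'm) tree) B (Diamond2 b)"
  using ex_new_if_finite[OF infinite_UNIV, of "\<Union>\<phi>\<in>forms T B. noms2 \<phi>"] finite_forms[OF assms, of T]
  by (auto simp: new_nominal_def finite_noms2)

section \<open>Codes of rule instances\<close>

text \<open>Instances of a diamond rule that differ in the new nominal only are the same task and
  share a code: a particular choice of the nominal ceases to be fresh as the branch
  grows, while the task remains. Since no rule has an empty list of alternatives, the codes of these
  instances differ from all others.\<close>

definition code ::
  "('n, 'm) rule_name \<Rightarrow> ('p::countable, 'n::countable, 'm::countable) form list \<Rightarrow>
   ('p, 'n, 'm) form list list \<Rightarrow> nat" where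
  "code r ps alts = to_nat (ps, if is_diamond_rule r then [] else alts)"

lemma rule_alts_nonempty: "rule r ps alts \<Longrightarrow> alts \<noteq> []"
  by (induction rule: rule.induct) auto

text \<open>Only freshness can keep a pending instance from being applied, and on a finite path there is
  always another nominal that is fresh.\<close>

lemma applicable_variant:
  fixes T :: "('p::countable, 'n::{countable,infinite}, 'm::{countable,infinite}) tree"
  assumes "rule r ps alts" and "premises_available T B r ps" and "\<not> fulfilled T B r ps alts"
    and "finite B"
  shows "\<exists>r' alts'. applicable T B r' ps alts' \<and> code r' ps alts' = code r ps alts"
proof (cases "is_diamond_rule r")
  case False
  then have "new_nominal T B r"
    by (auto simp: is_diamond_rule_def new_nominal_def split: rule_name.split)
  then show ?thesis
    using assms by (auto simp: applicable_def)
next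
  case True
  then consider j where "r = Diamond1 j" | b where "r = Diamond2 b"
    by (auto simp: is_diamond_rule_def)
  then show ?thesis
  proof cases
    case 1
    obtain j' where j': "new_nominal T B (Diamond1 j')"
      using ex_fresh1[OF \<open>finite B\<close>] by blast
    obtain alts' where "rule (Diamond1 j') ps alts'"
      using \<open>rule r ps alts\<close> unfolding 1 by (auto elim!: rule.cases intro: rule.intros)
    then have "applicable T B (Diamond1 j') ps alts'" "code (Diamond1 j') ps alts' = code r ps alts"
      using assms(2,3) j'
      by (auto simp: applicable_def premises_available_def restricted_rule_def fulfilled_def
          is_diamond_rule_def code_def 1)
    then show ?thesis
      by blast
  next
    case 2
    obtain b' where b': "new_nominal T B (Diamond2 b')"
      using ex_fresh2[OF \<open>finite B\<close>] by blast
    obtain alts' where "rule (Diamond2 b') ps alts'"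
      using \<open>rule r ps alts\<close> unfolding 2 by (auto elim!: rule.cases intro: rule.intros)
    then have "applicable T B (Diamond2 b') ps alts'" "code (Diamond2 b') ps alts' = code r ps alts"
      using assms(2,3) b'
      by (auto simp: applicable_def premises_available_def restricted_rule_def fulfilled_def
          is_diamond_rule_def code_def 2)
    then show ?thesis
      by blast
  qed
qed

text \<open>This is why no code is picked twice along a branch.\<close>

lemma fulfilled_after_application:
  assumes "rule r ps alts" and "rule r' ps' alts'" and "code r ps alts = code r' ps' alts'"
    and "T w = Some (Apply r ps fs)" and "fs \<in> set alts" and "w \<in> B"
  shows "fulfilled T B r' ps' alts'"
proof -
  have "ps' = ps" and "is_diamond_rule r' = is_diamond_rule r"
    and "\<not> is_diamond_rule r \<Longrightarrow> alts' = alts"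
    using assms(1-3) rule_alts_nonempty by (auto simp: code_def split: if_splits)
  moreover have "set fs \<subseteq> forms T B"
    using assms(4,6) by (force simp: forms_def)
  ultimately show ?thesis
    using assms(4-6) by (auto simp: fulfilled_def)
qed

section \<open>The fair tableau\<close>

definition pick ::
  "('p::countable, 'n::countable, 'm::countable) tree \<Rightarrow> nat list set \<Rightarrow>
   ('n, 'm) rule_name \<times> ('p, 'n, 'm) form list \<times> ('p, 'n, 'm) form list list" where
  "pick T B = (ARG_MIN (\<lambda>(r, ps, alts). code r ps alts) (r, ps, alts). applicable T B r ps alts)"

definition successor ::
  "('p::countable, 'n::countable, 'm::countable) tree \<Rightarrow> nat list \<Rightarrow> nat \<Rightarrow>
   ('p, 'n, 'm) node_label option" where
  "successor T u k =
     (if u \<in> dom T \<and> \<not> closed_branch T (path_to u) \<and> (\<exists>r ps alts. applicable T (path_to u) r ps alts)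
      then case pick T (path_to u) of (r, ps, alts) \<Rightarrow>
        if k < length alts then Some (Apply r ps (alts ! k)) else None
      else None)"

text \<open>The tableau is the limit of its parts of bounded depth.\<close>

primrec stage ::
  "('p::countable, 'n::countable, 'm::countable) form \<Rightarrow> nat \<Rightarrow> ('p, 'n, 'm) tree" where
  "stage \<chi> 0 = [[] \<mapsto> Start \<chi>]"
| "stage \<chi> (Suc n) =
     (\<lambda>v. if length v \<le> n then stage \<chi> n v else successor (stage \<chi> n) (butlast v) (last v))"

definition fair ::
  "('p::countable, 'n::countable, 'm::countable) form \<Rightarrow> ('p, 'n, 'm) tree" where
  "fair \<chi> v = stage \<chi> (length v) v"

lemma pick_minimal:
  assumes "pick T B = (r, ps, alts)" and "applicable T B r' ps' alts'"
  shows "applicable T B r ps alts" and "code r ps alts \<le> code r' ps' alts'"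
  using arg_min_nat_lemma[of "\<lambda>(r, ps, alts). applicable T B r ps alts" "(r', ps', alts')"
      "\<lambda>(r, ps, alts). code r ps alts"] assms
  by (auto simp: pick_def)

lemma stage_eq_fair: "length v \<le> n \<Longrightarrow> stage \<chi> n v = fair \<chi> v"
proof (induction n)
  case 0
  then show ?case
    by (simp add: fair_def)
next
  case (Suc n)
  show ?case
  proof (cases "length v = Suc n")
    case True
    then show ?thesis
      unfolding fair_def by (simp only:)
  next
    case False
    then have "length v \<le> n"
      using Suc.prems by simp
    then show ?thesis
      using Suc.IH by simp
  qed
qed

lemma successor_cong:
  assumes "\<And>v. prefix v u \<Longrightarrow> T v = T' v"
  shows "successor T u k = successor T' u k"
proof -
  have agree: "T v = T' v" if "v \<in> path_to u" for v
    using assms that by (simp add: path_to_def)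
  have "closed_branch T (path_to u) = closed_branch T' (path_to u)"
    by (rule agree_cong(1)) (rule agree)
  moreover have "applicable T (path_to u) = applicable T' (path_to u)"
    by (rule agree_cong(2)) (rule agree)
  moreover have "u \<in> dom T \<longleftrightarrow> u \<in> dom T'"
    using assms[of u] by (simp add: dom_def)
  ultimately show ?thesis
    unfolding successor_def pick_def by (simp only:)
qed

lemma fair_Nil [simp]: "fair \<chi> [] = Some (Start \<chi>)"
  by (simp add: fair_def)

lemma fair_snoc: "fair \<chi> (u @ [k]) = successor (fair \<chi>) u k"
proof -
  have "fair \<chi> (u @ [k]) = successor (stage \<chi> (length u)) u k"
    by (simp add: fair_def)
  also have "\<dots> = successor (fair \<chi>) u k"
    by (intro successor_cong stage_eq_fair prefix_length_le)
  finally show ?thesis .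
qed

lemma fair_dom_down: "\<forall>u k. u @ [k] \<in> dom (fair \<chi>) \<longrightarrow> u \<in> dom (fair \<chi>)"
  by (auto simp: fair_snoc successor_def split: if_splits)

lemma fair_expanded:
  assumes "u \<in> dom (fair \<chi>)" and "\<not> closed_branch (fair \<chi>) (path_to u)"
    and "applicable (fair \<chi>) (path_to u) r' ps' alts'"
    and "pick (fair \<chi>) (path_to u) = (r, ps, alts)"
  shows "expanded_by (fair \<chi>) u r ps alts"
  using assms pick_minimal(1)[OF assms(4,3)]
  by (auto simp: expanded_by_def applicable_def fair_snoc successor_def)

lemma fair_cases:
  assumes "u \<in> dom (fair \<chi>)"
  shows "(\<forall>k. fair \<chi> (u @ [k]) = None) \<or>
    \<not> closed_branch (fair \<chi>) (path_to u) \<and> (\<exists>r ps alts. expanded_by (fair \<chi>) u r ps alts)"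
proof (cases "\<not> closed_branch (fair \<chi>) (path_to u) \<and>
    (\<exists>r ps alts. applicable (fair \<chi>) (path_to u) r ps alts)")
  case True
  then show ?thesis
    using fair_expanded[OF assms] by (metis prod_cases3)
next
  case False
  then show ?thesis
    by (auto simp: fair_snoc successor_def)
qed

section \<open>Branches\<close>

lemma dom_prefix_closed:
  assumes "\<forall>u k. u @ [k] \<in> dom T \<longrightarrow> u \<in> dom T" and "v \<in> dom T" and "prefix u v"
  shows "u \<in> dom T"
  using assms(2,3)
proof (induction v rule: rev_induct)
  case (snoc k v)
  then show ?case
    using assms(1) by (metis prefix_snoc)
qed simp

text \<open>Maximality of a branch is used in this form only.\<close>

lemma branch_insert:
  assumes "branch T B" and "u \<in> dom T" and "\<And>v. v \<in> B \<Longrightarrow> prefix u v \<or> prefix v u"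
  shows "u \<in> B"
proof -
  have "path T (insert u B)"
    using assms by (auto simp: branch_def path_def)
  then have "insert u B = B"
    using assms(1) unfolding branch_def by blast
  then show ?thesis
    by blast
qed

lemma branch_root: "branch T B \<Longrightarrow> [] \<in> dom T \<Longrightarrow> [] \<in> B"
  using branch_insert by (metis Nil_prefix)

lemma branch_path_to:
  assumes down: "\<forall>u k. u @ [k] \<in> dom T \<longrightarrow> u \<in> dom T" and "branch T B" and "v \<in> B"
  shows "path_to v \<subseteq> B"
proof
  fix u assume "u \<in> path_to v"
  then have u: "prefix u v"
    by (simp add: path_to_def)
  have "v \<in> dom T"
    using assms(2,3) unfolding branch_def path_def by blast
  then have "u \<in> dom T"
    using dom_prefix_closed[OF down _ u] by blast
  moreover have "prefix u w \<or> prefix w u" if "w \<in> B" for w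
  proof -
    have "prefix v w \<or> prefix w v"
      using assms(2,3) that unfolding branch_def path_def by blast
    then show ?thesis
      using u prefix_same_cases[of u v w] prefix_order.trans[of u v w] by blast
  qed
  ultimately show "u \<in> B"
    using branch_insert[OF assms(2)] by blast
qed

lemma branch_extend:
  assumes down: "\<forall>u k. u @ [k] \<in> dom T \<longrightarrow> u \<in> dom T" and "branch T B" and "v \<in> B"
    and "v @ [k] \<in> dom T"
  shows "\<exists>k. v @ [k] \<in> B"
proof (rule ccontr)
  assume no: "\<nexists>k. v @ [k] \<in> B"
  have "prefix w v" if "w \<in> B" for w
  proof (rule ccontr)
    assume "\<not> prefix w v"
    moreover have "prefix v w \<or> prefix w v"
      using assms(2,3) that unfolding branch_def path_def by blast
    ultimately obtain xs where "w = v @ xs" "xs \<noteq> []"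
      by (auto elim!: prefixE)
    then obtain k' ys where "w = v @ k' # ys"
      by (cases xs) auto
    then have "v @ [k'] \<in> path_to w"
      by (simp add: path_to_def)
    then show False
      using no branch_path_to[OF down assms(2) that] by blast
  qed
  then have "v @ [k] \<in> B"
    using branch_insert[OF assms(2,4)] by simp
  then show False
    using no by blast
qed

lemma finitely_many_forms:
  assumes "branch T B" and "[] \<in> B" and "set ps \<subseteq> forms T B"
  shows "\<exists>u\<in>B. set ps \<subseteq> forms T (path_to u)"
  using assms(3)
proof (induction ps)
  case Nil
  then show ?case
    using \<open>[] \<in> B\<close> by auto
next
  case (Cons \<psi> ps)
  then obtain u where u: "u \<in> B" "set ps \<subseteq> forms T (path_to u)"
    by auto
  have "\<psi> \<in> forms T B"
    using Cons.prems by simp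
  then obtain v where v: "v \<in> B" "\<psi> \<in> forms T (path_to v)"
    by (auto simp: forms_def path_to_def)
  consider "prefix u v" | "prefix v u"
    using assms(1) u(1) v(1) unfolding branch_def path_def by blast
  then show ?case
    using u v forms_mono[OF path_to_mono, of u v T] forms_mono[OF path_to_mono, of v u T]
    by cases auto
qed

text \<open>An instance that stays pending from a node \<open>u\<close> of the branch onwards bounds the codes of the
  instances applied below \<open>u\<close>. These codes are pairwise distinct, so there are only finitely
  many nodes below \<open>u\<close>; but the last of them would still have a pending instance and thus a
  child.\<close>

lemma open_branch_saturated:
  fixes \<chi> :: "('p::countable, 'n::{countable,infinite}, 'm::{countable,infinite}) form"
  assumes br: "branch (fair \<chi>) B" and "open": "\<not> closed_branch (fair \<chi>) B"
  shows "saturated (fair \<chi>) B"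
proof (rule ccontr)
  let ?T = "fair \<chi>"
  assume "\<not> saturated ?T B"
  then obtain r ps alts where pending: "rule r ps alts" "premises_available ?T B r ps"
    "\<not> fulfilled ?T B r ps alts"
    by (auto simp: saturated_def)
  have root: "[] \<in> B"
    using branch_root[OF br] by (simp add: dom_def)
  have below: "path_to v \<subseteq> B" if "v \<in> B" for v
    using branch_path_to[OF fair_dom_down br that] .
  obtain u where u: "u \<in> B" "set ps \<subseteq> forms ?T (path_to u)"
    using finitely_many_forms[OF br root, of ps] pending(2) by (auto simp: premises_available_def)
  define S where "S = {v \<in> B. prefix u v}"
  \<comment> \<open>The pending instance itself may have lost its fresh nominal; a variant with the same code
    competes for being picked.\<close>
  have applied: "\<exists>r' ps' alts' k. pick ?T (path_to v) = (r', ps', alts') \<and>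
      applicable ?T (path_to v) r' ps' alts' \<and> code r' ps' alts' \<le> code r ps alts \<and>
      k < length alts' \<and> v @ [k] \<in> B \<and> ?T (v @ [k]) = Some (Apply r' ps' (alts' ! k))"
    if "v \<in> S" for v
  proof -
    have v: "v \<in> B" "prefix u v" "v \<in> dom ?T"
      using that br by (auto simp: S_def branch_def path_def)
    have "set ps \<subseteq> forms ?T (path_to v)"
      using u(2) forms_mono[OF path_to_mono[OF v(2)], of ?T] by blast
    then have "premises_available ?T (path_to v) r ps"
      using pending(2) accessibility_mono[OF below[OF v(1)], of ?T]
      by (auto simp: premises_available_def)
    moreover have "\<not> fulfilled ?T (path_to v) r ps alts"
      using pending(3) fulfilled_mono[OF below[OF v(1)]] by blast
    ultimately obtain r0 alts0
      where app0: "applicable ?T (path_to v) r0 ps alts0" and "code r0 ps alts0 = code r ps alts"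
      using applicable_variant[OF pending(1) _ _ finite_path_to] by blast
    obtain r' ps' alts' where pick: "pick ?T (path_to v) = (r', ps', alts')"
      by (metis prod_cases3)
    note min = pick_minimal[OF pick app0]
    have "\<not> closed_branch ?T (path_to v)"
      using "open" closed_branch_mono[OF below[OF v(1)]] by blast
    then have exp: "expanded_by ?T v r' ps' alts'"
      using fair_expanded[OF v(3) _ app0 pick] by blast
    then have "alts' \<noteq> []"
      using rule_alts_nonempty by (auto simp: expanded_by_def)
    then have "v @ [0] \<in> dom ?T"
      using exp by (auto simp: expanded_by_def)
    then obtain k where k: "v @ [k] \<in> B"
      using branch_extend[OF fair_dom_down br v(1)] by blast
    then have "?T (v @ [k]) \<noteq> None"
      using br by (auto simp: branch_def path_def)
    then have "k < length alts'" "?T (v @ [k]) = Some (Apply r' ps' (alts' ! k))"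
      using exp by (auto simp: expanded_by_def split: if_splits)
    then show ?thesis
      using pick min k \<open>code r0 ps alts0 = code r ps alts\<close> by auto
  qed
  define c where "c v = (case pick ?T (path_to v) of (r', ps', alts') \<Rightarrow> code r' ps' alts')" for v
  have distinct: "c v \<noteq> c w" if "v \<in> S" "w \<in> S" "strict_prefix v w" for v w
  proof
    assume "c v = c w"
    obtain r1 ps1 alts1 k where 1: "pick ?T (path_to v) = (r1, ps1, alts1)"
      "applicable ?T (path_to v) r1 ps1 alts1" "k < length alts1" "v @ [k] \<in> B"
      "?T (v @ [k]) = Some (Apply r1 ps1 (alts1 ! k))"
      using applied[OF \<open>v \<in> S\<close>] by blast
    obtain r2 ps2 alts2 where 2: "pick ?T (path_to w) = (r2, ps2, alts2)"
      "applicable ?T (path_to w) r2 ps2 alts2"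
      using applied[OF \<open>w \<in> S\<close>] by blast
    have "prefix (v @ [k]) w \<or> prefix w (v @ [k])"
      using br 1(4) \<open>w \<in> S\<close> unfolding S_def branch_def path_def by blast
    then have "v @ [k] \<in> path_to w"
      using \<open>strict_prefix v w\<close> by (auto simp: path_to_def)
    then have "fulfilled ?T (path_to w) r2 ps2 alts2"
      using fulfilled_after_application[of r1 ps1 alts1 r2 ps2 alts2 ?T "v @ [k]" "alts1 ! k"]
        1 2 \<open>c v = c w\<close> by (auto simp: c_def applicable_def)
    then show False
      using 2(2) by (simp add: applicable_def)
  qed
  have "inj_on c S"
  proof (rule inj_onI, rule ccontr)
    fix v w assume vw: "v \<in> S" "w \<in> S" "c v = c w" "v \<noteq> w"
    then have "prefix v w \<or> prefix w v"
      using br unfolding S_def branch_def path_def by blast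
    then show False
      using distinct[of v w] distinct[of w v] vw by (auto simp: strict_prefix_def)
  qed
  moreover have "c ` S \<subseteq> {..code r ps alts}"
    using applied by (fastforce simp: c_def)
  ultimately have "finite S"
    using finite_imageD finite_subset by blast
  have "u \<in> S"
    using u(1) by (simp add: S_def)
  then have "Max (length ` S) \<in> length ` S"
    using \<open>finite S\<close> by (intro Max_in) auto
  then obtain v where v: "v \<in> S" "length v = Max (length ` S)"
    by auto
  obtain k where "v @ [k] \<in> B"
    using applied[OF v(1)] by blast
  then have "v @ [k] \<in> S"
    using v(1) by (simp add: S_def)
  then have "length (v @ [k]) \<le> length v"
    using \<open>finite S\<close> unfolding v(2) by (intro Max_ge finite_imageI imageI)
  then show False
    by simp
qed

lemma tableau_fair:
  fixes \<chi> :: "('p::countable, 'n::{countable,infinite}, 'm::{countable,infinite}) form"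
  shows "tableau \<chi> (fair \<chi>)"
  unfolding tableau_def
proof (intro conjI)
  show "\<forall>u\<in>dom (fair \<chi>). (\<forall>k. fair \<chi> (u @ [k]) = None) \<or>
      \<not> closed_branch (fair \<chi>) (path_to u) \<and> (\<exists>r ps alts. expanded_by (fair \<chi>) u r ps alts)"
    using fair_cases by blast
  show "\<forall>B. branch (fair \<chi>) B \<longrightarrow> closed_branch (fair \<chi>) B \<or> saturated (fair \<chi>) B"
    using open_branch_saturated by blast
qed (rule fair_Nil fair_dom_down)+

section \<open>Open branches and completeness\<close>

lemma tableau_label:
  assumes "tableau \<chi> T" and "T w = Some (Apply r ps fs)"
  obtains v alts where "prefix v w" and "rule r ps alts" and "fs \<in> set alts"
    and "new_nominal T (path_to v) r"
proof (cases w rule: rev_cases)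
  case Nil
  then show ?thesis
    using assms by (simp add: tableau_def)
next
  case (snoc v k)
  then have "v \<in> dom T" "T (v @ [k]) \<noteq> None"
    using assms unfolding tableau_def by blast+
  moreover have "\<forall>u\<in>dom T. (\<forall>k. T (u @ [k]) = None) \<or>
      \<not> closed_branch T (path_to u) \<and> (\<exists>r ps alts. expanded_by T u r ps alts)"
    using assms(1) unfolding tableau_def by (elim conjE)
  ultimately obtain r' ps' alts where "expanded_by T v r' ps' alts"
    by metis
  then show ?thesis
    using that[of v alts] assms(2) snoc by (auto simp: expanded_by_def split: if_splits)
qed

lemma tableau_root:
  assumes "tableau \<chi> T" and "[] \<in> B"
  shows "\<chi> \<in> forms T B"
  using assms by (force simp: forms_def tableau_def)

text \<open>The root lies on the path to the node where \<open>b\<close> was required to be new.\<close>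

lemma accessibility_fresh:
  assumes tab: "tableau \<chi> T" and "\<psi> \<in> accessibility T B"
  obtains i a b where "\<psi> = At12 i a (Dia2 (Nom2 b))" and "b \<notin> noms2 \<chi>"
proof -
  obtain w b ps \<psi>' where "T w = Some (Apply (Diamond2 b) ps [\<psi>, \<psi>'])"
    using assms(2) by (auto simp: accessibility_def)
  then obtain v alts where v: "rule (Diamond2 b) ps alts" "[\<psi>, \<psi>'] \<in> set alts"
    "new_nominal T (path_to v) (Diamond2 b)"
    using tableau_label[OF tab] by metis
  have "\<chi> \<in> forms T (path_to v)"
    using tableau_root[OF tab] by (simp add: path_to_def)
  then have "b \<notin> noms2 \<chi>"
    using v(3) by (auto simp: new_nominal_def)
  then show ?thesis
    using v(1,2) that by (auto elim: rule.cases)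
qed

text \<open>Taking for \<open>N\<close> the nominals of the root
  keeps accessibility formulas out of the premises of the restricted rules. The nominal
  witnessing a diamond is the one of the instance that was actually applied on the branch.\<close>

lemma open_branch_hintikka:
  fixes \<chi> :: "('p::countable, 'n::countable, 'm::countable) form"
  assumes tab: "tableau \<chi> T" and br: "branch T B" and "open": "\<not> closed_branch T B"
  shows "hintikka (forms T B) (noms2 \<chi>)"
proof -
  let ?\<Theta> = "forms T B"
  have "saturated T B"
    using tab br "open" by (auto simp: tableau_def)
  then have fulfil: "fulfilled T B r ps alts"
    if "rule r ps alts" "set ps \<subseteq> ?\<Theta>" "restricted_rule r \<Longrightarrow> set ps \<inter> accessibility T B = {}"
    for r ps alts
    using that unfolding saturated_def premises_available_def by blast
  have add: "\<exists>fs\<in>set alts. set fs \<subseteq> ?\<Theta>"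
    if "rule r ps alts" "\<not> is_diamond_rule r" "set ps \<subseteq> ?\<Theta>"
      "restricted_rule r \<Longrightarrow> set ps \<inter> accessibility T B = {}" for r ps alts
    using fulfil[OF that(1,3,4)] that(2) by (simp add: fulfilled_def)
  have inaccessible: "At12 i a \<phi> \<notin> accessibility T B" if "noms2 \<phi> \<subseteq> noms2 \<chi>" for i a \<phi>
    using accessibility_fresh[OF tab, of "At12 i a \<phi>" B] that by force
  have inaccessible_nom: "At1 i (Nom1 j) \<notin> accessibility T B" "At2 a \<psi> \<notin> accessibility T B"
    for i j a \<psi>
    using accessibility_fresh[OF tab] by blast+
  note kinds = is_diamond_rule_def restricted_rule_def
  have diamond: "\<exists>r alts fs. is_diamond_rule r \<and> rule r ps alts \<and> fs \<in> set alts \<and> set fs \<subseteq> ?\<Theta>"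
    if prems: "is_diamond_rule r" "rule r ps alts" "set ps \<subseteq> ?\<Theta>"
      "restricted_rule r \<Longrightarrow> set ps \<inter> accessibility T B = {}" for r ps alts
  proof -
    obtain w r' fs where w: "w \<in> B" "T w = Some (Apply r' ps fs)" "is_diamond_rule r'"
      using fulfil[OF prems(2-4)] prems(1) by (auto simp: fulfilled_def)
    then obtain alts' where "rule r' ps alts'" "fs \<in> set alts'"
      using tableau_label[OF tab] by metis
    moreover have "set fs \<subseteq> ?\<Theta>"
      using w by (force simp: forms_def)
    ultimately show ?thesis
      using w(3) by blast
  qed
  show ?thesis
  proof
    show "At12 i a \<phi> \<in> ?\<Theta>" if "At12 i a (Neg (Neg \<phi>)) \<in> ?\<Theta>" for i a \<phi>
      using add[OF rule.intros(1)[of i a \<phi>]] that by (simp add: kinds)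
    show "At12 i a \<phi> \<in> ?\<Theta> \<and> At12 i a \<psi> \<in> ?\<Theta>" if "At12 i a (Con \<phi> \<psi>) \<in> ?\<Theta>" for i a \<phi> \<psi>
      using add[OF rule.intros(2)[of i a \<phi> \<psi>]] that by (simp add: kinds)
    show "At12 i a (Neg \<phi>) \<in> ?\<Theta> \<or> At12 i a (Neg \<psi>) \<in> ?\<Theta>" if "At12 i a (Neg (Con \<phi> \<psi>)) \<in> ?\<Theta>"
      for i a \<phi> \<psi>
      using add[OF rule.intros(3)[of i a \<phi> \<psi>]] that by (simp add: kinds)
    show "\<exists>j. At1 i (Dia1 (Nom1 j)) \<in> ?\<Theta> \<and> At12 j a \<phi> \<in> ?\<Theta>" if prem: "At12 i a (Dia1 \<phi>) \<in> ?\<Theta>"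
      for i a \<phi>
    proof -
      have "\<exists>r alts fs. is_diamond_rule r \<and> rule r [At12 i a (Dia1 \<phi>)] alts \<and> fs \<in> set alts \<and>
          set fs \<subseteq> ?\<Theta>"
        \<comment> \<open>which nominal this instance would introduce is immaterial\<close>
        by (rule diamond[OF _ rule.intros(4)]) (use prem in \<open>simp_all add: kinds\<close>)
      then show ?thesis
        by (fastforce simp: kinds elim: rule.cases)
    qed
    show "\<exists>b. At12 i a (Dia2 (Nom2 b)) \<in> ?\<Theta> \<and> At12 i b \<phi> \<in> ?\<Theta>"
      if prems: "At12 i a (Dia2 \<phi>) \<in> ?\<Theta>" "noms2 \<phi> \<subseteq> noms2 \<chi>" for i a \<phi>
    proof -
      have "\<exists>r alts fs. is_diamond_rule r \<and> rule r [At12 i a (Dia2 \<phi>)] alts \<and> fs \<in> set alts \<and>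
          set fs \<subseteq> ?\<Theta>"
        by (rule diamond[OF _ rule.intros(5)]) (use prems inaccessible[of "Dia2 \<phi>" i a] in \<open>simp_all add: kinds\<close>)
      then show ?thesis
        by (fastforce simp: kinds elim: rule.cases)
    qed
    show "At12 j a (Neg \<phi>) \<in> ?\<Theta>" if "At12 i a (Neg (Dia1 \<phi>)) \<in> ?\<Theta>" "At1 i (Dia1 (Nom1 j)) \<in> ?\<Theta>"
      for i j a \<phi>
      using add[OF rule.intros(6)[of i a \<phi> j]] that by (simp add: kinds)
    show "At12 i b (Neg \<phi>) \<in> ?\<Theta>"
      if "At12 i a (Neg (Dia2 \<phi>)) \<in> ?\<Theta>" "At12 i a (Dia2 (Nom2 b)) \<in> ?\<Theta>" for i a b \<phi>
      using add[OF rule.intros(7)[of i a \<phi> b]] that by (simp add: kinds)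
    show "At12 j a \<phi> \<in> ?\<Theta>" if "At12 i a (At1 j \<phi>) \<in> ?\<Theta>" for i j a \<phi>
      using add[OF rule.intros(8)[of i a j \<phi>]] that by (simp add: kinds)
    show "At12 i b \<phi> \<in> ?\<Theta>" if "At12 i a (At2 b \<phi>) \<in> ?\<Theta>" for i a b \<phi>
      using add[OF rule.intros(9)[of i a b \<phi>]] that by (simp add: kinds)
    show "At12 j a (Neg \<phi>) \<in> ?\<Theta>" if "At12 i a (Neg (At1 j \<phi>)) \<in> ?\<Theta>" for i j a \<phi>
      using add[OF rule.intros(10)[of i a j \<phi>]] that by (simp add: kinds)
    show "At12 i b (Neg \<phi>) \<in> ?\<Theta>" if "At12 i a (Neg (At2 b \<phi>)) \<in> ?\<Theta>" for i a b \<phi>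
      using add[OF rule.intros(11)[of i a b \<phi>]] that by (simp add: kinds)
    show "At1 i s \<in> ?\<Theta>" if "lit1 s" "At12 i a s \<in> ?\<Theta>" for i a s
      using add[OF rule.intros(12)[of s i a]] that by (simp add: kinds)
    show "At2 a t \<in> ?\<Theta>" if "lit2 t" "At12 i a t \<in> ?\<Theta>" for i a t
      using add[OF rule.intros(13)[of t i a]] that by (simp add: kinds)
    show "At1 j (Nom1 j) \<in> ?\<Theta>" if "At1 i (Neg (Nom1 j)) \<in> ?\<Theta>" for i j
      using add[OF rule.intros(14)[of i j]] that by (simp add: kinds)
    show "At2 b (Nom2 b) \<in> ?\<Theta>" if "At2 a (Neg (Nom2 b)) \<in> ?\<Theta>" for a b
      using add[OF rule.intros(15)[of a b]] that by (simp add: kinds)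
    show "At12 j a \<phi> \<in> ?\<Theta>"
      if "At12 i a \<phi> \<in> ?\<Theta>" "noms2 \<phi> \<subseteq> noms2 \<chi>" "At1 i (Nom1 j) \<in> ?\<Theta>" for i j a \<phi>
      using add[OF rule.intros(16)[of i a \<phi> j]] that inaccessible[of \<phi> i a] inaccessible_nom
      by (simp add: kinds)
    show "At12 i b \<phi> \<in> ?\<Theta>"
      if "At12 i a \<phi> \<in> ?\<Theta>" "noms2 \<phi> \<subseteq> noms2 \<chi>" "At2 a (Nom2 b) \<in> ?\<Theta>" for i a b \<phi>
      using add[OF rule.intros(17)[of i a \<phi> b]] that inaccessible[of \<phi> i a] inaccessible_nom
      by (simp add: kinds)
    show "At1 j s \<in> ?\<Theta>" if "lit1 s" "At1 i s \<in> ?\<Theta>" "At1 i (Nom1 j) \<in> ?\<Theta>" for i j s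
      using add[OF rule.intros(18)[of s i j]] that by (simp add: kinds)
    show "At2 b t \<in> ?\<Theta>" if "lit2 t" "At2 a t \<in> ?\<Theta>" "At2 a (Nom2 b) \<in> ?\<Theta>" for a b t
      using add[OF rule.intros(19)[of t a b]] that by (simp add: kinds)
  qed (use "open" in \<open>unfold closed_branch_def, blast+\<close>)
qed

theorem theorem6p10:
  fixes \<phi> :: "('p::countable, 'n::{countable,infinite}, 'm::{countable,infinite}) form"
  assumes "valid \<phi>"
  shows "provable \<phi>"
proof (rule ccontr)
  assume not_provable: "\<not> provable \<phi>"
  obtain i a where "i \<notin> noms1 \<phi>" "a \<notin> noms2 \<phi>"
    using ex_new_if_finite[OF infinite_UNIV finite_noms1]
      ex_new_if_finite[OF infinite_UNIV finite_noms2] by metis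
  let ?\<chi> = "At12 i a (Neg \<phi>)"
  have "\<not> closed_tableau ?\<chi> (fair ?\<chi>)"
    using not_provable \<open>i \<notin> noms1 \<phi>\<close> \<open>a \<notin> noms2 \<phi>\<close> unfolding provable_def by blast
  then obtain B where B: "branch (fair ?\<chi>) B" "\<not> closed_branch (fair ?\<chi>) B"
    using tableau_fair unfolding closed_tableau_def by blast
  have "[] \<in> B"
    using branch_root[OF B(1)] by (simp add: dom_def)
  then have "?\<chi> \<in> forms (fair ?\<chi>) B"
    using tableau_root[OF tableau_fair] by blast
  moreover have "hintikka (forms (fair ?\<chi>) B) (noms2 ?\<chi>)"
    using open_branch_hintikka[OF tableau_fair B] .
  ultimately have "\<not> valid \<phi>"
    using hintikka.not_valid by fastforce
  then show False
    using \<open>valid \<phi>\<close> by blast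
qed

end
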